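(* Let $q$ be a nonzero complex number with $|q|<1$. The third order mock theta functions $\psi(q)$ and $\nu(q)$ have the following Hecke-type double sum representations: \begin{align*} 1+2\psi(q)&=\frac{1}{(q)_{\infty}}\sum_{n=0}^{\infty}(-1)^nq^{2n^2+n}(1+q^{2n+1})\sum_{j=-n}^nq^{-\binom{j+1}{2}},\\ \nu(-q)&=\frac{1}{(q)_{\infty}}\sum_{n=0}^{\infty}(-1)^nq^{2n^2+2n}\sum_{j=-n}^nq^{-\binom{j+1}{2}}. \end{align*}
   Context: Notation: $(x;q)_n:=\prod_{i=0}^{n-1}(1-q^ix)$, $(x;q)_\infty:=\prod_{i\ge 0}(1-q^ix)$, and $(q)_\infty:=(q;q)_\infty$. For every integer $j$, $\binom{j+1}{2}:=j(j+1)/2$. The third order mock theta functions are $$\psi(q):=\sum_{n=1}^{\infty}\frac{q^{n^2}}{(q;q^2)_n},\qquad \nu(q):=\sum_{n=0}^{\infty}\frac{q^{n(n+1)}}{(-q;q^2)_{n+1}}.$$ *)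

theory Defs
  imports "HOL-Analysis.Analysis"
begin

definition qpoch :: "complex \<Rightarrow> complex \<Rightarrow> nat \<Rightarrow> complex" where
  "qpoch x q n = (\<Prod>i<n. 1 - q ^ i * x)"

definition qpoch_inf :: "complex \<Rightarrow> complex \<Rightarrow> complex" where
  "qpoch_inf x q = (\<Prod>i. 1 - q ^ i * x)"

definition euler_q :: "complex \<Rightarrow> complex" where
  "euler_q q = qpoch_inf q q"

text \<open>The division is exact, since \<open>j * (j + 1)\<close> is always even.\<close>

definition tri :: "int \<Rightarrow> int" where
  "tri j = j * (j + 1) div 2"

text \<open>The series for \<open>\<psi>\<close> runs over the positive integers, hence the shift to \<open>Suc n\<close>.\<close>

definition mock_psi :: "complex \<Rightarrow> complex" where
  "mock_psi q = (\<Sum>n. q ^ ((Suc n)\<^sup>2) / qpoch q (q\<^sup>2) (Suc n))"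

definition mock_nu :: "complex \<Rightarrow> complex" where
  "mock_nu q = (\<Sum>n. q ^ (n * (n + 1)) / qpoch (- q) (q\<^sup>2) (n + 1))"

end

theory Submission
  imports Defs
begin

text \<open>
  With \<open>S\<^sub>r = \<Sum>\<^bsub>|j|\<le>r\<^esub> q\<^bsup>-j(j+1)/2\<^esup>\<close> and \<open>a\<^sub>r = (-1)\<^sup>r q\<^bsup>r^2+r\<^esup> S\<^sub>r\<close>, the finite identity
  \<open>\<Sum>\<^bsub>r\<le>n\<^esub> a\<^sub>r / ((q)\<^bsub>n-r\<^esub> (q)\<^bsub>n+r+1\<^esub>) = 1 / (q;q\<^sup>2)\<^bsub>n+1\<^esub>\<close> holds by induction on \<open>n\<close>: the vanishing of
  \<open>(1 - q\<^bsup>2n+1\<^esup>) F\<^sub>n - F\<^bsub>n-1\<^esub>\<close> for the left-hand side \<open>F\<^sub>n\<close> follows by writing it as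
  \<open>\<Sum>\<^sub>r (g\<^sub>r - g\<^bsub>r+1\<^esub>) S\<^sub>r\<close>; after summation by parts only the simple
  increments of \<open>S\<^sub>r\<close> remain, which telescope to zero. A linear combination of two such identities
  gives the analogue with value \<open>2 / (q;q\<^sup>2)\<^sub>n\<close>. Multiplying these by \<open>q\<^bsup>n^2+n\<^esup>\<close> and \<open>q\<^bsup>n^2\<^esup>\<close>, summing over
  \<open>n\<close> and exchanging the order of summation, the inner sums are all of the form
  \<open>\<Sum>\<^sub>m q\<^bsup>m^2+mk\<^esup> / ((q)\<^sub>m (q)\<^bsub>m+k\<^esub>) = 1 / (q)\<^sub>\<infinity>\<close>.
\<close>

section \<open>Summation along antidiagonals\<close>

text \<open>The product majorant makes the family absolutely summable over all pairs, so summing by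
  rows and summing along \<open>r + m = n\<close> give the same value.\<close>

lemma sums_diagonal:
  fixes c :: "nat \<Rightarrow> nat \<Rightarrow> 'a :: banach" and b e :: "nat \<Rightarrow> real"
  assumes bound: "\<And>r m. norm (c r m) \<le> b r * e m"
    and b: "summable b" "\<And>r. b r \<ge> 0" and e: "summable e" "\<And>m. e m \<ge> 0"
    and rows: "\<And>r. c r sums s r"
  shows "(\<lambda>n. \<Sum>r\<le>n. c r (n - r)) sums (\<Sum>r. s r)"
proof -
  have "(\<lambda>(r, m). b r * e m) summable_on UNIV \<times> UNIV"
  proof (rule summable_on_SigmaI)
    show "((\<lambda>m. case (r, m) of (r, m) \<Rightarrow> b r * e m) has_sum b r * suminf e) UNIV" for r
      using e by (auto intro!: has_sum_cmult_right norm_summable_imp_has_sum summable_sums)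
    show "(\<lambda>r. b r * suminf e) summable_on UNIV"
      using b e by (subst summable_on_UNIV_nonneg_real_iff) (auto intro!: summable_mult2 suminf_nonneg mult_nonneg_nonneg)
  qed (use b e in auto)
  then have "(\<lambda>(r, m). c r m) abs_summable_on UNIV \<times> UNIV"
    by (rule Infinite_Sum.abs_summable_on_comparison_test') (auto simp: bound)
  then obtain S where S: "((\<lambda>(r, m). c r m) has_sum S) (UNIV \<times> UNIV)"
    using abs_summable_summable summable_on_def by blast
  have "(s has_sum S) UNIV"
  proof (rule has_sum_SigmaD[OF S])
    fix r
    have "summable (\<lambda>m. norm (c r m))"
      by (rule summable_comparison_test'[OF summable_mult[OF e(1), of "b r"], where N = 0]) (simp add: bound)
    then show "((\<lambda>m. case (r, m) of (r, m) \<Rightarrow> c r m) has_sum s r) UNIV"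
      using rows by (simp add: norm_summable_imp_has_sum)
  qed
  then have "S = (\<Sum>r. s r)"
    by (simp add: has_sum_imp_sums sums_unique)
  \<comment> \<open>The substitution \<open>n = r + m\<close> is a bijection onto the pairs with
    \<open>r \<le> n\<close>, where the truncated \<open>n - r\<close> recovers
    \<open>m\<close>.\<close>
  have "((\<lambda>(n, r). c r (n - r)) has_sum S) (SIGMA n:UNIV. {..n})"
    by (rule iffD1[OF has_sum_reindex_bij_witness[where i = "\<lambda>(n, r). (r, n - r)"
          and j = "\<lambda>(r, m). (r + m, r)"] S]) auto
  then have "((\<lambda>n. \<Sum>r\<le>n. c r (n - r)) has_sum S) UNIV"
    by (rule has_sum_SigmaD) (simp add: has_sum_finite)
  then show ?thesis
    using \<open>S = _\<close> by (simp add: has_sum_imp_sums)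
qed

section \<open>Finite q-Pochhammer products and a telescoping sum\<close>

context
  fixes q :: complex
  assumes q_nonzero: "q \<noteq> 0" and norm_q: "norm q < 1"
begin

abbreviation P :: "nat \<Rightarrow> complex" where
  "P n \<equiv> qpoch q q n"

definition tri_sum :: "nat \<Rightarrow> complex" where
  "tri_sum n = (\<Sum>j = - int n..int n. q powi (- tri j))"

definition hecke_coeff :: "nat \<Rightarrow> complex" where
  "hecke_coeff r = (-1) ^ r * q ^ (r\<^sup>2 + r) * tri_sum r"

lemma power_q_neq_one: "n > 0 \<Longrightarrow> q ^ n \<noteq> 1"
  by (metis norm_q norm_ge_zero norm_one norm_power order_less_irrefl power_less_one_iff)

lemma qpoch_0 [simp]: "qpoch x y 0 = 1"
  by (simp add: qpoch_def)

lemma qpoch_Suc: "qpoch x y (Suc n) = qpoch x y n * (1 - y ^ n * x)"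
  by (simp add: qpoch_def)

lemma P_Suc: "P (Suc n) = P n * (1 - q ^ Suc n)"
  by (simp add: qpoch_Suc mult.commute)

lemma P_nonzero [simp]: "P n \<noteq> 0"
proof (induction n)
  case (Suc n)
  then show ?case
    using power_q_neq_one[of "Suc n"] by (simp add: P_Suc)
qed simp

text \<open>Multiplied by \<open>- (1 - q ^ n)\<close>, the summand becomes the forward difference
  of an explicit \<open>h\<close>, so only the value at \<open>t = 0\<close> survives. This
  evaluates the sum left over after summation by parts in \<open>hecke_telescoping\<close>.\<close>

lemma alternating_triangular_sum:
  assumes "n > 0"
  shows "(\<Sum>t<n. (-1) ^ Suc t * q ^ (t * (t + 1) div 2) * (1 + q ^ Suc t) /
            (P (n - Suc t) * P (n + Suc t))) = - 1 / (P n)\<^sup>2"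
proof -
  \<comment> \<open>The cut-off at \<open>t = n\<close> encodes the convention that 1/(q)_{-1} is
    zero; truncated subtraction alone would give a wrong end value.\<close>
  define h where
    "h t = (if t < n then (-1) ^ Suc t * q ^ (t * (t + 1) div 2) / (P (n - Suc t) * P (n + t)) else 0)"
    for t
  have step: "h (Suc t) - h t = - (1 - q ^ n) * ((-1) ^ Suc t * q ^ (t * (t + 1) div 2) *
      (1 + q ^ Suc t) / (P (n - Suc t) * P (n + Suc t)))" if "t < n" for t
  proof (cases "Suc t < n")
    case True
    then obtain d where n: "n = Suc (Suc (t + d))"
      using less_imp_Suc_add[OF True] by auto
    have e: "Suc t * (Suc t + 1) div 2 = t * (t + 1) div 2 + Suc t"
      by simp
    have nz: "1 - q ^ Suc d \<noteq> 0" "1 - q ^ Suc (n + t) \<noteq> 0"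
      using power_q_neq_one[of "Suc d"] power_q_neq_one[of "Suc (n + t)"] by auto
    have hS: "h (Suc t) = (-1) ^ Suc t * q ^ (t * (t + 1) div 2) * (- (q ^ Suc t) * (1 - q ^ Suc d)) /
        (P (Suc d) * P (n + Suc t))"
      unfolding h_def e power_add using True nz by (simp add: n P_Suc)
    have h: "h t = (-1) ^ Suc t * q ^ (t * (t + 1) div 2) * (1 - q ^ Suc (n + t)) /
        (P (Suc d) * P (n + Suc t))"
      using True nz by (simp add: h_def n P_Suc)
    have "- (q ^ Suc t) * (1 - q ^ Suc d) - (1 - q ^ Suc (n + t)) = - (1 - q ^ n) * (1 + q ^ Suc t)"
      by (simp add: n power_add algebra_simps)
    moreover have "n - Suc t = Suc d"
      by (simp add: n)
    moreover have "K * A / D - K * B / D = - u * (K * v / D)" if "A - B = - u * v"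
      for K A B D u v :: complex
    proof -
      have "K * A / D - K * B / D = K * (A - B) / D"
        by (simp add: right_diff_distrib diff_divide_distrib)
      then show ?thesis
        using that by simp
    qed
    ultimately show ?thesis
      unfolding hS h by (simp only:)
  next
    case False
    then have n: "n = Suc t"
      using that by simp
    \<comment> \<open>At the last index \<open>h (Suc t) = 0\<close>, and this factorisation
      supplies both the multiplier \<open>1 - q ^ n\<close> and the factor
      \<open>1 + q ^ Suc t\<close>.\<close>
    have factor: "1 - q ^ Suc (n + t) = (1 - q ^ n) * (1 + q ^ n)"
      by (simp add: n power_add algebra_simps)
    then have "P (n + n) = P (n + t) * ((1 - q ^ n) * (1 + q ^ n))"
      by (metis P_Suc add_Suc_right n)
    moreover have "(1 - q ^ n) * (1 + q ^ n) \<noteq> 0"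
      using power_q_neq_one[of "Suc (n + t)"] unfolding factor[symmetric] by simp
    moreover have "h n = 0" "h t = (-1) ^ n * q ^ (t * (t + 1) div 2) / P (n + t)"
      by (simp_all add: h_def n)
    moreover have "0 - G / p = - a * (G * b / (1 * (p * (a * b))))" if "a * b \<noteq> 0" for G p a b :: complex
      using that by simp
    ultimately show ?thesis
      unfolding n[symmetric] by (simp only: diff_self_eq_0 qpoch_0)
  qed
  have "- (1 - q ^ n) * (\<Sum>t<n. (-1) ^ Suc t * q ^ (t * (t + 1) div 2) * (1 + q ^ Suc t) /
            (P (n - Suc t) * P (n + Suc t))) = (\<Sum>t<n. h (Suc t) - h t)"
    unfolding sum_distrib_left by (intro sum.cong refl) (simp only: step lessThan_iff)
  also have "\<dots> = 1 / (P (n - 1) * P n)"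
    unfolding sum_lessThan_telescope using assms by (simp add: h_def)
  also have "\<dots> = (1 - q ^ n) / (P n)\<^sup>2"
    using P_Suc[of "n - 1"] assms power_q_neq_one[of n] by (simp add: power2_eq_square)
  finally have "- (1 - q ^ n) * (\<Sum>t<n. (-1) ^ Suc t * q ^ (t * (t + 1) div 2) * (1 + q ^ Suc t) /
            (P (n - Suc t) * P (n + Suc t))) = (1 - q ^ n) / (P n)\<^sup>2" .
  moreover have "s = - 1 / p" if "- y * s = y / p" "y \<noteq> 0" for y s p :: complex
  proof -
    have "y * s = y * (- 1 / p)"
      using that(1) by (metis minus_minus mult_minus_left mult_minus_right mult_1_right
          minus_divide_left times_divide_eq_right)
    then show ?thesis
      using that(2) mult_left_cancel by blast
  qed
  moreover have "1 - q ^ n \<noteq> 0"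
    using power_q_neq_one[OF assms] by simp
  ultimately show ?thesis
    by blast
qed

section \<open>Increments of the triangular power sums\<close>

lemma tri_sum_0 [simp]: "tri_sum 0 = 1"
  by (simp add: tri_sum_def tri_def)

lemma tri_of_nat: "tri (int n) = int (n * (n + 1) div 2)"
  by (simp add: tri_def zdiv_int algebra_simps)

text \<open>The reflection j -> -1-j preserves \<open>tri\<close>, so the new index -(n+1)
  contributes the exponent belonging to n.\<close>

lemma tri_sum_Suc: "tri_sum (Suc n) = tri_sum n + q powi (- tri (int (Suc n))) + q powi (- tri (int n))"
proof -
  have "{- int (Suc n)..int (Suc n)} = insert (int (Suc n)) (insert (- int (Suc n)) {- int n..int n})"
    by auto
  moreover have "tri (- int (Suc n)) = tri (int n)"
    by (simp add: tri_def algebra_simps)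
  ultimately show ?thesis
    by (simp add: tri_sum_def)
qed

lemma power_times_powi_tri:
  assumes "k = m + n * (n + 1) div 2"
  shows "q ^ k * q powi (- tri (int n)) = q ^ m"
  using q_nonzero unfolding assms tri_of_nat
  by (simp add: power_add power_int_minus)

text \<open>Consecutive triangular numbers add up to a square, T_t + T_{t+1} = (t+1)^2, so the
  factor \<open>q ^ (Suc t)\<^sup>2\<close> turns the two negative exponents into T_t and T_{t+1} =
  T_t + t + 1.\<close>

lemma square_times_tri_sum_diff:
  "q ^ (Suc t)\<^sup>2 * (tri_sum (Suc t) - tri_sum t) = q ^ (t * (t + 1) div 2) * (1 + q ^ Suc t)"
proof -
  obtain k where k: "t * (t + 1) = 2 * k"
    using evenE[of "t * (t + 1)"] by auto
  have k': "Suc t * (Suc t + 1) = 2 * (k + Suc t)"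
    using k by simp
  have 1: "(Suc t)\<^sup>2 = t * (t + 1) div 2 + Suc t * (Suc t + 1) div 2"
    "(Suc t)\<^sup>2 = (t * (t + 1) div 2 + Suc t) + t * (t + 1) div 2"
    by (simp only: k k', use k in \<open>simp add: power2_eq_square\<close>)+
  have "u * (s + v + w - s) = u * v + u * w" for u v w s :: complex
    by (simp add: algebra_simps)
  then show ?thesis
    unfolding tri_sum_Suc
    by (simp only: power_times_powi_tri[OF 1(1)] power_times_powi_tri[OF 1(2)] power_add
        distrib_left mult_1_right)
qed

section \<open>Finite identities of Bailey type\<close>

text \<open>With a = q^(n-r) and b = q^(n+r+1), the numerator is (1 - ab) - (1-a)(1-b) = a + b -
  2ab, the one arising from the recurrence for the odd identity. For \<open>n = 0\<close> the sum
  would be 1.\<close>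

lemma hecke_telescoping:
  assumes "n > 0"
  shows "(\<Sum>r\<le>n. hecke_coeff r * (q ^ (n - r) + q ^ (n + r + 1) - 2 * q ^ (2 * n + 1)) /
            (P (n - r) * P (n + r + 1))) = 0"
proof -
  \<comment> \<open>Again the cut-off supplies the value 0 at \<open>r = n + 1\<close>, which is
    needed for the last difference.\<close>
  define g where "g r = (if r \<le> n then (-1) ^ r * q ^ (r\<^sup>2 + n) / (P (n - r) * P (n + r)) else 0)" for r
  have step: "(-1) ^ r * q ^ (r\<^sup>2 + r) * (q ^ (n - r) + q ^ (n + r + 1) - 2 * q ^ (2 * n + 1)) /
            (P (n - r) * P (n + r + 1)) = g r - g (Suc r)" if "r \<le> n" for r
  proof (cases "r < n")
    case True
    then obtain d where n: "n = Suc (r + d)"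
      by (metis less_natE)
    have nz: "1 - q ^ Suc d \<noteq> 0" "1 - q ^ Suc (n + r) \<noteq> 0"
      using power_q_neq_one[of "Suc d"] power_q_neq_one[of "Suc (n + r)"] by auto
    have 1: "g r = (-1) ^ r * q ^ (r\<^sup>2 + n) * (1 - q ^ Suc (n + r)) / (P (Suc d) * P (n + Suc r))"
      using True nz by (simp add: g_def n P_Suc)
    have 2: "g (Suc r) = - ((-1) ^ r * q ^ ((Suc r)\<^sup>2 + n) * (1 - q ^ Suc d)) / (P (Suc d) * P (n + Suc r))"
      using True nz by (simp add: g_def n P_Suc)
    have 3: "q ^ (r\<^sup>2 + r) * (q ^ Suc d + q ^ (n + r + 1) - 2 * q ^ (2 * n + 1)) =
       q ^ (r\<^sup>2 + n) * (1 - q ^ Suc (n + r)) + q ^ ((Suc r)\<^sup>2 + n) * (1 - q ^ Suc d)"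
    proof -
      have "r\<^sup>2 + n = (r\<^sup>2 + r) + Suc d" "(Suc r)\<^sup>2 + n = (r\<^sup>2 + r) + (n + r + 1)"
        "2 * n + 1 = (n + r + 1) + Suc d" "Suc (n + r) = n + r + 1"
        by (simp_all add: n power2_eq_square)
      then have "q ^ (r\<^sup>2 + n) = q ^ (r\<^sup>2 + r) * q ^ Suc d"
        "q ^ ((Suc r)\<^sup>2 + n) = q ^ (r\<^sup>2 + r) * q ^ (n + r + 1)"
        "q ^ (2 * n + 1) = q ^ (n + r + 1) * q ^ Suc d" "q ^ Suc (n + r) = q ^ (n + r + 1)"
        by (simp_all only: power_add)
      moreover have "u * (w + v - 2 * (v * w)) = u * w * (1 - v) + u * v * (1 - w)" for u v w :: complex
        by (simp add: algebra_simps)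
      ultimately show ?thesis
        by (simp only:)
    qed
    have "(-1) ^ r * q ^ (r\<^sup>2 + r) * (q ^ Suc d + q ^ (n + r + 1) - 2 * q ^ (2 * n + 1)) =
      (-1) ^ r * q ^ (r\<^sup>2 + n) * (1 - q ^ Suc (n + r)) + (-1) ^ r * q ^ ((Suc r)\<^sup>2 + n) * (1 - q ^ Suc d)"
      unfolding mult.assoc 3 by (simp only: distrib_left mult.assoc)
    then show ?thesis
      unfolding 1 2 by (simp add: n add_divide_distrib)
  next
    case False
    then have n: "r = n"
      using that by simp
    have nz: "1 - q ^ Suc (n + n) \<noteq> 0"
      using power_q_neq_one[of "Suc (n + n)"] by auto
    have "q ^ (n - n) + q ^ (n + n + 1) - 2 * q ^ (2 * n + 1) = 1 - q ^ Suc (n + n)"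
    proof -
      have "2 * n + 1 = Suc (n + n)" "n + n + 1 = Suc (n + n)"
        by simp_all
      moreover have "1 + x - 2 * x = 1 - x" for x :: complex
        by simp
      ultimately show ?thesis
        by (simp only: diff_self_eq_0 power_0)
    qed
    moreover have "P (n + n + 1) = P (n + n) * (1 - q ^ Suc (n + n))"
      by (simp only: Suc_eq_plus1[symmetric] P_Suc)
    moreover have "g n = (-1) ^ n * q ^ (n\<^sup>2 + n) / P (n + n)" "g (Suc n) = 0"
      by (simp_all add: g_def)
    ultimately show ?thesis
      using nz unfolding n by (simp only: diff_self_eq_0 qpoch_0) simp
  qed
  \<comment> \<open>Summation by parts; the boundary term vanishes for \<open>m = n\<close> because
    \<open>g (Suc n) = 0\<close>.\<close>
  have abel: "(\<Sum>r\<le>m. (g r - g (Suc r)) * tri_sum r) =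
      g 0 + (\<Sum>t<m. g (Suc t) * (tri_sum (Suc t) - tri_sum t)) - g (Suc m) * tri_sum m" for m
    by (induction m) (simp_all add: algebra_simps)
  have g_diff: "g (Suc t) * (tri_sum (Suc t) - tri_sum t) = q ^ n * ((-1) ^ Suc t *
      q ^ (t * (t + 1) div 2) * (1 + q ^ Suc t) / (P (n - Suc t) * P (n + Suc t)))" if "t < n" for t
  proof -
    have "g (Suc t) * (tri_sum (Suc t) - tri_sum t) = q ^ n * ((-1) ^ Suc t *
      (q ^ (Suc t)\<^sup>2 * (tri_sum (Suc t) - tri_sum t)) / (P (n - Suc t) * P (n + Suc t)))"
      using that by (simp add: g_def power_add)
    then show ?thesis
      by (simp only: square_times_tri_sum_diff mult.assoc)
  qed
  have "(\<Sum>r\<le>n. hecke_coeff r * (q ^ (n - r) + q ^ (n + r + 1) - 2 * q ^ (2 * n + 1)) /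
            (P (n - r) * P (n + r + 1))) = (\<Sum>r\<le>n. (g r - g (Suc r)) * tri_sum r)"
    by (intro sum.cong refl) (simp add: step[symmetric] hecke_coeff_def)
  also have "\<dots> = g 0 + (\<Sum>t<n. g (Suc t) * (tri_sum (Suc t) - tri_sum t))"
  proof -
    have "g (Suc n) = 0"
      by (simp add: g_def)
    then show ?thesis
      unfolding abel by simp
  qed
  \<comment> \<open>The increments of \<open>tri_sum\<close> produce \<open>q ^ n\<close> times the
    sum already evaluated, which is exactly \<open>- g 0\<close>.\<close>
  also have "\<dots> = g 0 - q ^ n / (P n)\<^sup>2"
  proof -
    have "(\<Sum>t<n. g (Suc t) * (tri_sum (Suc t) - tri_sum t)) = q ^ n * (\<Sum>t<n. (-1) ^ Suc t *
      q ^ (t * (t + 1) div 2) * (1 + q ^ Suc t) / (P (n - Suc t) * P (n + Suc t)))"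
      unfolding sum_distrib_left by (intro sum.cong refl) (simp only: g_diff lessThan_iff)
    then show ?thesis
      by (simp only: alternating_triangular_sum[OF assms]) simp
  qed
  also have "\<dots> = 0"
    by (simp add: g_def power2_eq_square)
  finally show ?thesis .
qed

lemma odd_qpoch_Suc: "qpoch q (q\<^sup>2) (Suc n) = qpoch q (q\<^sup>2) n * (1 - q ^ (2 * n + 1))"
  by (simp only: qpoch_Suc power_add power_mult power_one_right)

text \<open>Up to the factor 1 - q, this is a Bailey pair relative to a = q. The induction shows
  that both sides satisfy the same first-order recurrence.\<close>

lemma bailey_pair_odd:
  "(\<Sum>r\<le>n. hecke_coeff r / (P (n - r) * P (n + r + 1))) = 1 / qpoch q (q\<^sup>2) (n + 1)"
proof (induction n)
  case 0
  then show ?case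
    by (simp add: hecke_coeff_def qpoch_Suc)
next
  case (Suc n)
  let ?N = "Suc n"
  have nz: "1 - q ^ (2 * ?N + 1) \<noteq> 0"
    using power_q_neq_one[of "2 * ?N + 1"] by simp
  \<comment> \<open>The subtracted sum is zero by \<open>hecke_telescoping\<close>; it converts the
    numerator 1 - ab into (1-a)(1-b).\<close>
  have "(\<Sum>r\<le>?N. hecke_coeff r / (P (?N - r) * P (?N + r + 1))) * (1 - q ^ (2 * ?N + 1)) =
    (\<Sum>r\<le>?N. hecke_coeff r * (1 - q ^ (2 * ?N + 1)) / (P (?N - r) * P (?N + r + 1))) -
    (\<Sum>r\<le>?N. hecke_coeff r * (q ^ (?N - r) + q ^ (?N + r + 1) - 2 * q ^ (2 * ?N + 1)) /
            (P (?N - r) * P (?N + r + 1)))"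
    by (simp only: hecke_telescoping zero_less_Suc sum_distrib_right times_divide_eq_left diff_zero)
  also have "\<dots> = (\<Sum>r\<le>?N. hecke_coeff r * ((1 - q ^ (?N - r)) * (1 - q ^ (?N + r + 1))) /
            (P (?N - r) * P (?N + r + 1)))"
    unfolding sum_subtractf[symmetric]
  proof (intro sum.cong refl)
    fix r assume "r \<in> {..?N}"
    then have "q ^ (2 * ?N + 1) = q ^ (?N - r) * q ^ (?N + r + 1)"
      by (simp add: power_add[symmetric] mult_2)
    then show "hecke_coeff r * (1 - q ^ (2 * ?N + 1)) / (P (?N - r) * P (?N + r + 1)) -
       hecke_coeff r * (q ^ (?N - r) + q ^ (?N + r + 1) - 2 * q ^ (2 * ?N + 1)) /
            (P (?N - r) * P (?N + r + 1)) = hecke_coeff r * ((1 - q ^ (?N - r)) * (1 - q ^ (?N + r + 1))) /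
            (P (?N - r) * P (?N + r + 1))"
      unfolding diff_divide_distrib[symmetric] by (simp only:) (simp add: algebra_simps)
  qed
  \<comment> \<open>The term \<open>r = ?N\<close> drops out since its factor
    \<open>1 - q ^ 0\<close> is zero; in the others the two factors cancel the last factors of the
    denominators.\<close>
  also have "\<dots> = (\<Sum>r\<le>n. hecke_coeff r * ((1 - q ^ (?N - r)) * (1 - q ^ (?N + r + 1))) /
            (P (?N - r) * P (?N + r + 1)))"
    by simp
  also have "\<dots> = (\<Sum>r\<le>n. hecke_coeff r / (P (n - r) * P (n + r + 1)))"
  proof (intro sum.cong refl)
    fix r assume "r \<in> {..n}"
    then have "?N - r = Suc (n - r)" "?N + r + 1 = Suc (n + r + 1)"
      by auto
    then show "hecke_coeff r * ((1 - q ^ (?N - r)) * (1 - q ^ (?N + r + 1))) /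
            (P (?N - r) * P (?N + r + 1)) = hecke_coeff r / (P (n - r) * P (n + r + 1))"
      using power_q_neq_one[of "Suc (n - r)"] power_q_neq_one[of "Suc (n + r + 1)"]
      by (simp only: P_Suc) simp
  qed
  also note Suc.IH
  finally have "(\<Sum>r\<le>?N. hecke_coeff r / (P (?N - r) * P (?N + r + 1))) * (1 - q ^ (2 * ?N + 1)) =
      1 / qpoch q (q\<^sup>2) ?N"
    by simp
  moreover have "F = 1 / (Q * y)" if "F * y = 1 / Q" "y \<noteq> 0" for F Q y :: complex
    using that by (metis divide_divide_eq_left nonzero_mult_div_cancel_right)
  ultimately show ?case
    using nz by (simp only: Suc_eq_plus1[symmetric] odd_qpoch_Suc[of ?N])
qed

text \<open>Over the common denominator of \<open>bailey_pair_odd\<close> the numerators are 1 - b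
  and 1 - a; adding the vanishing sum with numerator a + b - 2ab leaves the constant 2(1 -
  ab).\<close>

lemma bailey_pair_even:
  "(\<Sum>r\<le>Suc n. hecke_coeff r / (P (Suc n - r) * P (Suc n + r))) +
   (\<Sum>r\<le>n. hecke_coeff r / (P (n - r) * P (n + r + 2))) = 2 / qpoch q (q\<^sup>2) (Suc n)"
proof -
  let ?N = "Suc n"
  define D where "D r = P (?N - r) * P (?N + r + 1)" for r
  have 1: "hecke_coeff r / (P (?N - r) * P (?N + r)) = hecke_coeff r * (1 - q ^ (?N + r + 1)) / D r" for r
    using power_q_neq_one[of "Suc (?N + r)"] by (simp add: D_def P_Suc)
  have 2: "hecke_coeff r / (P (n - r) * P (n + r + 2)) = hecke_coeff r * (1 - q ^ (?N - r)) / D r"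
    if "r \<in> {..n}" for r
  proof -
    have "?N - r = Suc (n - r)"
      using that by auto
    then show ?thesis
      using power_q_neq_one[of "Suc (n - r)"] by (simp add: D_def P_Suc[of "n - r"])
  qed
  have "(\<Sum>r\<le>?N. hecke_coeff r / (P (?N - r) * P (?N + r))) +
      (\<Sum>r\<le>n. hecke_coeff r / (P (n - r) * P (n + r + 2))) =
      (\<Sum>r\<le>?N. hecke_coeff r * (1 - q ^ (?N + r + 1)) / D r) +
      (\<Sum>r\<le>n. hecke_coeff r * (1 - q ^ (?N - r)) / D r)"
    by (simp only: 1 2 cong: sum.cong)
  \<comment> \<open>The second sum may be extended to \<open>r = ?N\<close>, where its factor is
    zero, and the third sum is zero by \<open>hecke_telescoping\<close>.\<close>
  also have "\<dots> = (\<Sum>r\<le>?N. hecke_coeff r * (1 - q ^ (?N + r + 1)) / D r) +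
      (\<Sum>r\<le>?N. hecke_coeff r * (1 - q ^ (?N - r)) / D r) +
      (\<Sum>r\<le>?N. hecke_coeff r * (q ^ (?N - r) + q ^ (?N + r + 1) - 2 * q ^ (2 * ?N + 1)) / D r)"
    unfolding D_def hecke_telescoping[OF zero_less_Suc] by simp
  also have "\<dots> = 2 * (1 - q ^ (2 * ?N + 1)) * (\<Sum>r\<le>?N. hecke_coeff r / D r)"
    unfolding sum.distrib[symmetric] sum_distrib_left add_divide_distrib[symmetric]
    by (intro sum.cong refl) (simp add: algebra_simps diff_divide_distrib)
  also have "(\<Sum>r\<le>?N. hecke_coeff r / D r) = 1 / qpoch q (q\<^sup>2) (?N + 1)"
    unfolding D_def by (rule bailey_pair_odd)
  also have "?N + 1 = Suc ?N"
    by simp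
  also have "2 * (1 - q ^ (2 * ?N + 1)) * (1 / qpoch q (q\<^sup>2) (Suc ?N)) = 2 / qpoch q (q\<^sup>2) ?N"
  proof -
    have "2 * y * (1 / (Q * y)) = 2 / Q" if "y \<noteq> 0" for Q y :: complex
      using that by simp
    moreover have "1 - q ^ (2 * ?N + 1) \<noteq> 0"
      using power_q_neq_one[of "2 * ?N + 1"] by simp
    ultimately show ?thesis
      by (simp only: odd_qpoch_Suc[of ?N])
  qed
  finally show ?thesis .
qed

section \<open>Convergence of the Euler product\<close>

lemma abs_convergent_euler: "abs_convergent_prod (\<lambda>i. 1 - q ^ i * q)"
proof -
  have "summable (\<lambda>i. norm q ^ i * norm q)"
    using norm_q by (intro summable_mult2 summable_geometric) simp
  then show ?thesis
    by (intro summable_imp_abs_convergent_prod) (simp add: norm_mult norm_power)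
qed

lemma one_minus_nonzero: "1 - q ^ i * q \<noteq> 0"
  using power_q_neq_one[of "Suc i"] by (simp add: mult.commute)

lemma euler_q_nonzero: "euler_q q \<noteq> 0"
  unfolding euler_q_def qpoch_inf_def
  using abs_convergent_prod_imp_convergent_prod[OF abs_convergent_euler] one_minus_nonzero
  by (rule prodinf_nonzero)

lemma P_tendsto: "P \<longlonglongrightarrow> euler_q q"
  unfolding euler_q_def qpoch_inf_def qpoch_def LIMSEQ_lessThan_iff_atMost
  by (rule convergent_prod_LIMSEQ[OF abs_convergent_prod_imp_convergent_prod[OF abs_convergent_euler]])

lemma inverse_P_tendsto: "(\<lambda>n. 1 / P n) \<longlonglongrightarrow> 1 / euler_q q"
  by (intro tendsto_divide tendsto_const P_tendsto euler_q_nonzero)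

lemma inverse_P_bounded: "\<exists>C>0. \<forall>n. norm (1 / P n) \<le> C"
  using BseqE[OF convergent_imp_Bseq[OF convergentI[OF inverse_P_tendsto]]] by metis

section \<open>Durfee rectangle series\<close>

text \<open>Generating function of the partitions whose Durfee rectangle has sides m and m + k, as
  the exponent is m(m+k).\<close>

definition durfee_term :: "nat \<Rightarrow> nat \<Rightarrow> complex" where
  "durfee_term k m = q ^ (m\<^sup>2 + m * k) / (P m * P (m + k))"

text \<open>The first bound is uniform in \<open>k\<close> and serves as a majorant for double sums;
  the second shows that all terms beyond \<open>m = 0\<close> decay as \<open>k\<close>
  grows.\<close>

lemma durfee_term_bound:
  "\<exists>B>0. (\<forall>k m. norm (durfee_term k m) \<le> B * norm q ^ m) \<and>
     (\<forall>k m. norm (durfee_term k (Suc m)) \<le> norm q ^ k * (B * norm q ^ m))"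
proof -
  obtain C where C: "C > 0" "\<And>n. norm (1 / P n) \<le> C"
    using inverse_P_bounded by blast
  have bound: "norm (durfee_term k m) \<le> C\<^sup>2 * norm q ^ e" if "e \<le> m\<^sup>2 + m * k" for k m e
  proof -
    have "norm (durfee_term k m) = norm q ^ (m\<^sup>2 + m * k) * (norm (1 / P m) * norm (1 / P (m + k)))"
      by (simp add: durfee_term_def norm_mult norm_divide norm_power)
    also have "\<dots> \<le> norm q ^ e * (C * C)"
      using C norm_q that by (intro mult_mono power_decreasing) auto
    finally show ?thesis
      by (simp add: power2_eq_square mult.commute)
  qed
  have "m \<le> m\<^sup>2 + m * k" for m k :: nat
    by (simp add: power2_nat_le_imp_le power2_eq_square trans_le_add1)
  then have 1: "norm (durfee_term k m) \<le> C\<^sup>2 * norm q ^ m" for k m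
    by (rule bound)
  have "k + m \<le> (Suc m)\<^sup>2 + Suc m * k" for m k :: nat
    by (simp add: power2_eq_square)
  then have 2: "norm (durfee_term k (Suc m)) \<le> C\<^sup>2 * norm q ^ (k + m)" for k m
    by (rule bound)
  show ?thesis
    using 1 2 C(1) by (intro exI[of _ "C\<^sup>2"]) (simp add: power_add mult.left_commute)
qed

lemma summable_durfee_norm: "summable (\<lambda>m. norm (durfee_term k m))"
proof -
  obtain B where B: "\<And>k m. norm (durfee_term k m) \<le> B * norm q ^ m"
    using durfee_term_bound by blast
  have "summable (\<lambda>m. B * norm q ^ m)"
    using norm_q by (intro summable_mult summable_geometric) simp
  then show ?thesis
    by (rule summable_comparison_test'[where N = 0]) (simp add: B)
qed

lemma summable_durfee: "summable (durfee_term k)"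
  using summable_durfee_norm by (rule summable_norm_cancel)

definition durfee :: "nat \<Rightarrow> complex" where
  "durfee k = (\<Sum>m. durfee_term k m)"

text \<open>Only the term \<open>m = 0\<close>, equal to \<open>1 / P k\<close>, survives in the
  limit; the rest is at most a constant times \<open>norm q ^ k\<close>.\<close>

lemma durfee_tendsto: "durfee \<longlonglongrightarrow> 1 / euler_q q"
proof -
  obtain B where B: "\<And>k m. norm (durfee_term k (Suc m)) \<le> norm q ^ k * (B * norm q ^ m)"
    using durfee_term_bound by blast
  have sB: "summable (\<lambda>m. B * norm q ^ m)"
    using norm_q by (intro summable_mult summable_geometric) simp
  define K where "K = (\<Sum>m. B * norm q ^ m)"
  have bound: "norm (durfee k - 1 / P k) \<le> norm q ^ k * K" for k
  proof -
    have "durfee k - 1 / P k = (\<Sum>m. durfee_term k (Suc m))"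
    proof -
      have "durfee_term k 0 = 1 / P k"
        by (simp add: durfee_term_def)
      then show ?thesis
        using suminf_split_head[OF summable_durfee[of k]] by (simp add: durfee_def)
    qed
    also have "norm \<dots> \<le> (\<Sum>m. norm q ^ k * (B * norm q ^ m))"
    proof -
      have s: "summable (\<lambda>m. norm (durfee_term k (Suc m)))"
        using summable_durfee_norm[of k] by (subst summable_Suc_iff)
      show ?thesis
        by (rule order.trans[OF summable_norm[OF s] suminf_le[OF B s summable_mult[OF sB]]])
    qed
    also have "\<dots> = norm q ^ k * K"
      unfolding K_def using sB by (rule suminf_mult)
    finally show ?thesis .
  qed
  have "(\<lambda>k. norm q ^ k * K) \<longlonglongrightarrow> 0"
    using norm_q by (intro tendsto_mult_left_zero LIMSEQ_power_zero) simp
  then have "(\<lambda>k. durfee k - 1 / P k) \<longlonglongrightarrow> 0"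
    by (rule Lim_null_comparison[rotated]) (simp add: bound)
  from tendsto_add[OF this inverse_P_tendsto] show ?thesis
    by simp
qed

text \<open>Over a common denominator, the numerator (1 - q^(m+k+1)) - q^m regroups as (1 - q^m) -
  q^(k+1) q^m. The first part vanishes at \<open>m = 0\<close> and, after an index shift, is a
  multiple of the series for \<open>k + 2\<close>.\<close>

lemma durfee_step: "durfee k - durfee (Suc k) = - (q ^ Suc k) * (durfee (Suc k) - durfee (Suc (Suc k)))"
proof -
  define u where "u m = q ^ (m\<^sup>2 + m * k) * (1 - q ^ m) / (P m * P (m + k + 1))" for m
  have split: "durfee_term k m - durfee_term (Suc k) m = u m - q ^ Suc k * durfee_term (Suc k) m" for m
  proof -
    have nz: "1 - q ^ Suc (m + k) \<noteq> 0"
      using power_q_neq_one[of "Suc (m + k)"] by simp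
    have 1: "durfee_term k m = q ^ (m\<^sup>2 + m * k) * (1 - q ^ Suc (m + k)) / (P m * P (m + k + 1))"
      using nz by (simp add: durfee_term_def P_Suc)
    have 2: "durfee_term (Suc k) m = q ^ (m\<^sup>2 + m * k) * q ^ m / (P m * P (m + k + 1))"
      by (simp add: durfee_term_def power_add)
    have 3: "q ^ Suc (m + k) = q ^ Suc k * q ^ m"
      by (simp add: power_add)
    have "U * (1 - x * y) / d - U * y / d = U * (1 - y) / d - x * (U * y / d)" for U x y d :: complex
      by (simp add: algebra_simps diff_divide_distrib)
    then show ?thesis
      unfolding 1 2 3 u_def .
  qed
  have u_Suc: "u (Suc m) = q ^ Suc k * durfee_term (Suc (Suc k)) m" for m
  proof -
    have "1 - q ^ Suc m \<noteq> 0"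
      using power_q_neq_one[of "Suc m"] by simp
    moreover have "(Suc m)\<^sup>2 + Suc m * k = Suc k + (m\<^sup>2 + m * Suc (Suc k))"
      by (simp add: power2_eq_square)
    moreover have "Suc m + k + 1 = m + Suc (Suc k)"
      by simp
    ultimately show ?thesis
      unfolding u_def durfee_term_def by (simp only: P_Suc[of m] power_add) simp
  qed
  have "u sums (q ^ Suc k * durfee (Suc (Suc k)))"
  proof -
    have "(\<lambda>m. u (Suc m)) sums (q ^ Suc k * durfee (Suc (Suc k)))"
      unfolding u_Suc durfee_def by (intro sums_mult summable_sums summable_durfee)
    then show ?thesis
      by (subst (asm) sums_Suc_iff) (simp add: u_def)
  qed
  then have "(\<lambda>m. durfee_term k m - durfee_term (Suc k) m) sums
      (q ^ Suc k * durfee (Suc (Suc k)) - q ^ Suc k * durfee (Suc k))"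
    unfolding split durfee_def by (intro sums_diff sums_mult summable_sums summable_durfee)
  moreover have "(\<lambda>m. durfee_term k m - durfee_term (Suc k) m) sums (durfee k - durfee (Suc k))"
    unfolding durfee_def by (intro sums_diff summable_sums summable_durfee)
  ultimately have "durfee k - durfee (Suc k) = q ^ Suc k * durfee (Suc (Suc k)) - q ^ Suc k * durfee (Suc k)"
    by (rule sums_unique2[symmetric])
  then show ?thesis
    by (simp only: right_diff_distrib minus_mult_left[symmetric]) simp
qed

text \<open>
  By \<open>durfee_step\<close> the differences of consecutive values do not decrease in modulus, but they tend
  to zero, so the sequence is constant.
\<close>

lemma durfee_eq: "durfee k = 1 / euler_q q"
proof -
  define \<delta> where "\<delta> k = norm (durfee k - durfee (Suc k))" for k
  have "\<delta> k = norm q ^ Suc k * \<delta> (Suc k)" for k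
    unfolding \<delta>_def by (subst durfee_step) (simp only: norm_mult norm_minus_cancel norm_power)
  moreover have "norm q ^ Suc k * x \<le> x" if "x \<ge> 0" for k x
    using norm_q that by (intro mult_left_le_one_le power_le_one) auto
  ultimately have mono: "\<delta> k \<le> \<delta> (Suc k)" for k
    by (metis \<delta>_def norm_ge_zero)
  have "\<delta> \<longlonglongrightarrow> norm (1 / euler_q q - 1 / euler_q q)"
    unfolding \<delta>_def by (intro tendsto_norm tendsto_diff durfee_tendsto LIMSEQ_Suc)
  then have "\<delta> k \<le> norm (1 / euler_q q - 1 / euler_q q)" for k
    using incseq_le[of \<delta>] mono by (simp add: incseq_SucI)
  then have "durfee (Suc k) = durfee k" for k
    by (simp add: \<delta>_def)
  then have "durfee = (\<lambda>_. durfee k)"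
    by (metis lift_Suc_mono_le lift_Suc_antimono_le order_antisym order_refl nat_le_linear ext)
  then have "(\<lambda>_::nat. durfee k) \<longlonglongrightarrow> 1 / euler_q q"
    using durfee_tendsto by metis
  then show ?thesis
    by (simp add: LIMSEQ_const_iff)
qed

section \<open>Exchange of summation for the Hecke coefficients\<close>

text \<open>For |j| \<le> r the exponent \<open>tri j\<close> is at most r^2, so
  \<open>q ^ r\<^sup>2\<close> absorbs the negative power and each of the 2r + 1 summands is at most
  \<open>norm q ^ r\<close>.\<close>

lemma hecke_coeff_bound: "norm (hecke_coeff r) \<le> 2 * (real (Suc r) * norm q ^ r)"
proof -
  have summand: "norm (q ^ (r\<^sup>2 + r) * q powi (- tri j)) \<le> norm q ^ r" if "j \<in> {- int r..int r}" for j
  proof -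
    \<comment> \<open>The witness is j itself or, for negative j, its reflection -1-j.\<close>
    obtain i where i: "tri j = int (i * (i + 1) div 2)" "i \<le> r"
    proof (cases "j \<ge> 0")
      case True
      then show ?thesis
        using that[of "nat j"] \<open>j \<in> _\<close> tri_of_nat[of "nat j"] by auto
    next
      case False
      moreover have "tri j = tri (- 1 - j)"
        by (simp add: tri_def algebra_simps)
      ultimately show ?thesis
        using that[of "nat (- 1 - j)"] \<open>j \<in> _\<close> tri_of_nat[of "nat (- 1 - j)"] by auto
    qed
    have "i * (i + 1) \<le> r * (r + 1)"
      using i by (intro mult_mono) auto
    moreover have "r * (r + 1) \<le> 2 * r\<^sup>2"
      by (simp add: power2_eq_square)
    ultimately have "i * (i + 1) div 2 \<le> r\<^sup>2"
      by linarith
    then obtain m where m: "r\<^sup>2 = m + i * (i + 1) div 2"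
      by (metis le_add_diff_inverse2)
    have "q ^ (r\<^sup>2 + r) * q powi (- tri j) = q ^ (m + r)"
      using power_times_powi_tri[of "r\<^sup>2 + r" "m + r" i] m i(1) tri_of_nat[of i] by simp
    then show ?thesis
      using norm_q by (simp add: norm_power power_decreasing)
  qed
  have "norm (hecke_coeff r) = norm (\<Sum>j = - int r..int r. q ^ (r\<^sup>2 + r) * q powi (- tri j))"
    by (simp add: hecke_coeff_def tri_sum_def norm_mult norm_power sum_distrib_left[symmetric])
  also have "\<dots> \<le> (\<Sum>j = - int r..int r. norm q ^ r)"
    by (rule sum_norm_le) (rule summand)
  also have "\<dots> = real (2 * r + 1) * norm q ^ r"
    by simp
  also have "\<dots> \<le> 2 * (real (Suc r) * norm q ^ r)"
    by (simp add: algebra_simps)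
  finally show ?thesis .
qed

lemma summable_linear_geometric: "summable (\<lambda>r. 2 * (real (Suc r) * norm q ^ r))"
  using norm_q by (intro summable_mult sums_summable[OF geometric_deriv_sums]) simp

text \<open>Every row sums to \<open>1 / euler_q q\<close> times its coefficient, whatever the shift
  \<open>k r\<close>. Both \<open>w\<close> and \<open>k\<close> stay arbitrary because three
  different choices are needed.\<close>

lemma hecke_swap:
  "(\<lambda>n. \<Sum>r\<le>n. hecke_coeff r * q ^ w r * durfee_term (k r) (n - r)) sums
     (1 / euler_q q * (\<Sum>r. hecke_coeff r * q ^ w r))"
  "summable (\<lambda>r. hecke_coeff r * q ^ w r)"
proof -
  obtain B where B: "B > 0" "\<And>k m. norm (durfee_term k m) \<le> B * norm q ^ m"
    using durfee_term_bound by blast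
  have coeff: "norm (hecke_coeff r * q ^ w r) \<le> 2 * (real (Suc r) * norm q ^ r)" for r
  proof -
    have "norm (hecke_coeff r * q ^ w r) \<le> norm (hecke_coeff r)"
      using norm_q by (simp add: norm_mult norm_power mult_right_le_one_le power_le_one)
    then show ?thesis
      using hecke_coeff_bound order_trans by blast
  qed
  show summable: "summable (\<lambda>r. hecke_coeff r * q ^ w r)"
    by (rule summable_comparison_test'[OF summable_linear_geometric, where N = 0]) (rule coeff)
  have "(\<lambda>n. \<Sum>r\<le>n. hecke_coeff r * q ^ w r * durfee_term (k r) (n - r)) sums
     (\<Sum>r. hecke_coeff r * q ^ w r * (1 / euler_q q))"
  proof (rule sums_diagonal)
    show "norm (hecke_coeff r * q ^ w r * durfee_term (k r) m) \<le>
        2 * (real (Suc r) * norm q ^ r) * (B * norm q ^ m)" for r m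
      unfolding norm_mult[of "hecke_coeff r * q ^ w r"] using B coeff by (intro mult_mono) auto
    show "summable (\<lambda>m. B * norm q ^ m)"
      using norm_q by (intro summable_mult summable_geometric) simp
    show "(\<lambda>m. hecke_coeff r * q ^ w r * durfee_term (k r) m) sums
        (hecke_coeff r * q ^ w r * (1 / euler_q q))" for r
      unfolding durfee_eq[of "k r", symmetric] durfee_def
      by (intro sums_mult summable_sums summable_durfee)
  qed (use B summable_linear_geometric in auto)
  then show "(\<lambda>n. \<Sum>r\<le>n. hecke_coeff r * q ^ w r * durfee_term (k r) (n - r)) sums
     (1 / euler_q q * (\<Sum>r. hecke_coeff r * q ^ w r))"
    using suminf_mult2[OF summable] by (simp add: mult.commute)
qed

lemma hecke_term:
  assumes "w + m\<^sup>2 + m * k = e" "m + k = l"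
  shows "hecke_coeff r * q ^ w * durfee_term k m = q ^ e * (hecke_coeff r / (P m * P l))"
  by (simp add: durfee_term_def power_add flip: assms)

text \<open>The expansion of (r + (n-r))^2; it makes the total power of q independent of
  \<open>r\<close>, so that it can leave the inner sum.\<close>

lemma square_shift:
  fixes n r :: nat
  assumes "r \<le> n"
  shows "r\<^sup>2 + (n - r)\<^sup>2 + (n - r) * (2 * r) = n\<^sup>2"
proof -
  obtain d where "n = r + d"
    using assms le_Suc_ex by blast
  then show ?thesis
    by (simp add: power2_eq_square algebra_simps)
qed

section \<open>The two Hecke-type representations\<close>

lemma nu_hecke:
  "mock_nu (- q) = 1 / euler_q q * (\<Sum>n. (-1) ^ n * q ^ (2 * n\<^sup>2 + 2 * n) * tri_sum n)"
proof -
  \<comment> \<open>The shift \<open>2 * r + 1\<close> yields the denominators of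
    \<open>bailey_pair_odd\<close>, and the weight \<open>r\<^sup>2 + r\<close> completes the
    exponent to n^2 + n.\<close>
  have "(\<lambda>n. \<Sum>r\<le>n. hecke_coeff r * q ^ (r\<^sup>2 + r) * durfee_term (2 * r + 1) (n - r)) sums
      (1 / euler_q q * (\<Sum>r. hecke_coeff r * q ^ (r\<^sup>2 + r)))"
    by (rule hecke_swap)
  moreover have "(\<Sum>r\<le>n. hecke_coeff r * q ^ (r\<^sup>2 + r) * durfee_term (2 * r + 1) (n - r)) =
      (- q) ^ (n * (n + 1)) / qpoch (- (- q)) ((- q)\<^sup>2) (n + 1)" for n
  proof -
    have "(\<Sum>r\<le>n. hecke_coeff r * q ^ (r\<^sup>2 + r) * durfee_term (2 * r + 1) (n - r)) =
      (\<Sum>r\<le>n. q ^ (n\<^sup>2 + n) * (hecke_coeff r / (P (n - r) * P (n + r + 1))))"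
    proof (intro sum.cong refl)
      fix r assume "r \<in> {..n}"
      then have r: "r \<le> n"
        by simp
      have "r\<^sup>2 + r + (n - r)\<^sup>2 + (n - r) * (2 * r + 1) = n\<^sup>2 + n"
        using square_shift[OF r] r by simp
      moreover have "n - r + (2 * r + 1) = n + r + 1"
        using r by simp
      ultimately show "hecke_coeff r * q ^ (r\<^sup>2 + r) * durfee_term (2 * r + 1) (n - r) =
        q ^ (n\<^sup>2 + n) * (hecke_coeff r / (P (n - r) * P (n + r + 1)))"
        by (rule hecke_term)
    qed
    moreover have "(- q) ^ (n * (n + 1)) = q ^ (n\<^sup>2 + n)"
      by (simp add: power2_eq_square add.commute)
    ultimately show ?thesis
      by (simp only: sum_distrib_left[symmetric] bailey_pair_odd minus_minus power2_minus) simp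
  qed
  ultimately have "mock_nu (- q) = 1 / euler_q q * (\<Sum>r. hecke_coeff r * q ^ (r\<^sup>2 + r))"
    unfolding mock_nu_def by (simp add: sums_iff)
  moreover have "hecke_coeff r * q ^ (r\<^sup>2 + r) = (-1) ^ r * q ^ (2 * r\<^sup>2 + 2 * r) * tri_sum r" for r
    by (simp add: hecke_coeff_def power_add mult_2)
  ultimately show ?thesis
    by simp
qed

text \<open>The factor 1 + q^(2r+1) splits the Hecke series into weights r^2 and (r+1)^2, matching
  the two sums of \<open>bailey_pair_even\<close>.\<close>

lemma psi_hecke:
  "1 + 2 * mock_psi q =
    1 / euler_q q * (\<Sum>n. (-1) ^ n * q ^ (2 * n\<^sup>2 + n) * (1 + q ^ (2 * n + 1)) * tri_sum n)"
proof -
  define X where "X n = (\<Sum>r\<le>n. hecke_coeff r * q ^ r\<^sup>2 * durfee_term (2 * r) (n - r))" for n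
  define Y where "Y n = (\<Sum>r\<le>n. hecke_coeff r * q ^ (Suc r)\<^sup>2 * durfee_term (2 * r + 2) (n - r))" for n
  define x where "x = (\<Sum>r. hecke_coeff r * q ^ r\<^sup>2)"
  define y where "y = (\<Sum>r. hecke_coeff r * q ^ (Suc r)\<^sup>2)"
  have X: "X sums (1 / euler_q q * x)"
    unfolding X_def x_def by (rule hecke_swap)
  have Y: "Y sums (1 / euler_q q * y)"
    unfolding Y_def y_def by (rule hecke_swap)
  have X_eq: "X n = q ^ n\<^sup>2 * (\<Sum>r\<le>n. hecke_coeff r / (P (n - r) * P (n + r)))" for n
    unfolding X_def sum_distrib_left
  proof (intro sum.cong refl)
    fix r assume "r \<in> {..n}"
    then have r: "r \<le> n"
      by simp
    have "n - r + 2 * r = n + r"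
      using r by simp
    then show "hecke_coeff r * q ^ r\<^sup>2 * durfee_term (2 * r) (n - r) =
        q ^ n\<^sup>2 * (hecke_coeff r / (P (n - r) * P (n + r)))"
      by (intro hecke_term square_shift r)
  qed
  have Y_eq: "Y n = q ^ (Suc n)\<^sup>2 * (\<Sum>r\<le>n. hecke_coeff r / (P (n - r) * P (n + r + 2)))" for n
    unfolding Y_def sum_distrib_left
  proof (intro sum.cong refl)
    fix r assume "r \<in> {..n}"
    then have r: "r \<le> n"
      by simp
    have "n - r + (2 * r + 2) = n + r + 2"
      using r by simp
    then show "hecke_coeff r * q ^ (Suc r)\<^sup>2 * durfee_term (2 * r + 2) (n - r) =
        q ^ (Suc n)\<^sup>2 * (hecke_coeff r / (P (n - r) * P (n + r + 2)))"
      using square_shift[of "Suc r" "Suc n"] r by (intro hecke_term) simp_all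
  qed
  \<comment> \<open>This term is the isolated 1 on the left-hand side. Removing it pairs
    \<open>X (Suc n)\<close> with \<open>Y n\<close>, which share the power
    \<open>q ^ (Suc n)\<^sup>2\<close>.\<close>
  have "X 0 = 1"
    by (simp add: X_eq hecke_coeff_def)
  then have "(\<lambda>n. X (Suc n)) sums (1 / euler_q q * x - 1)"
    using X by (simp add: sums_Suc_iff)
  from sums_add[OF this Y] have "(\<lambda>n. X (Suc n) + Y n) sums (1 / euler_q q * (x + y) - 1)"
    by (simp add: algebra_simps add_divide_distrib)
  moreover have "X (Suc n) + Y n = 2 * (q ^ (Suc n)\<^sup>2 / qpoch q (q\<^sup>2) (Suc n))" for n
    unfolding X_eq Y_eq distrib_left[symmetric] bailey_pair_even by simp
  ultimately have "(\<lambda>n. 2 * (q ^ (Suc n)\<^sup>2 / qpoch q (q\<^sup>2) (Suc n))) sums (1 / euler_q q * (x + y) - 1)"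
    by simp
  from sums_mult[OF this, of "1 / 2"] have "2 * mock_psi q = 1 / euler_q q * (x + y) - 1"
    unfolding mock_psi_def by (simp add: sums_iff mult.commute)
  moreover have "x + y = (\<Sum>r. hecke_coeff r * q ^ r\<^sup>2 + hecke_coeff r * q ^ (Suc r)\<^sup>2)"
    unfolding x_def y_def by (intro suminf_add hecke_swap)
  moreover have "hecke_coeff r * q ^ r\<^sup>2 + hecke_coeff r * q ^ (Suc r)\<^sup>2 =
      (-1) ^ r * q ^ (2 * r\<^sup>2 + r) * (1 + q ^ (2 * r + 1)) * tri_sum r" for r
  proof -
    have "(Suc r)\<^sup>2 = r\<^sup>2 + (2 * r + 1)"
      by (simp add: power2_eq_square)
    moreover have "2 * r\<^sup>2 + r = r\<^sup>2 + r + r\<^sup>2"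
      by simp
    ultimately have "q ^ (Suc r)\<^sup>2 = q ^ r\<^sup>2 * q ^ (2 * r + 1)"
      "q ^ (2 * r\<^sup>2 + r) = q ^ (r\<^sup>2 + r) * q ^ r\<^sup>2"
      by (simp_all only: power_add)
    then show ?thesis
      unfolding hecke_coeff_def by (simp only:) (simp add: algebra_simps)
  qed
  ultimately show ?thesis
    by simp
qed

end

theorem theorem1p5:
  fixes q :: complex
  assumes "q \<noteq> 0" and "norm q < 1"
  shows "1 + 2 * mock_psi q =
           1 / euler_q q *
             (\<Sum>n. (-1) ^ n * q ^ (2 * n\<^sup>2 + n) * (1 + q ^ (2 * n + 1)) *
                (\<Sum>j = - int n..int n. q powi (- tri j))) \<and>
         mock_nu (- q) =
           1 / euler_q q *
             (\<Sum>n. (-1) ^ n * q ^ (2 * n\<^sup>2 + 2 * n) *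
                (\<Sum>j = - int n..int n. q powi (- tri j)))"
  using psi_hecke[OF assms] nu_hecke[OF assms] by (simp only: tri_sum_def[OF assms] simp_thms)

end
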